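(* Let $\mathcal{I}$ be an admissible ideal of $\mathbb{N}$. Let $(X,d)$ and $(Y,\rho)$ be two metric spaces, let $h:X\to Y$ be a uniform homeomorphism, and let $F=\{f_n\}_{n\in\mathbb{N}}$ (maps $f_n:X\to X$) and $G=\{g_n\}_{n\in\mathbb{N}}$ (maps $g_n:Y\to Y$) be uniformly $h$-conjugate. If $F$ is $\mathcal{I}$-exhaustive on $X$, then $G$ is $\mathcal{I}$-exhaustive on $Y$.
   Context: An ideal of $\mathbb{N}$ (positive integers) is a family $\mathcal{I}\subset 2^{\mathbb{N}}$ such that $A,B\in\mathcal{I}$ implies $A\cup B\in\mathcal{I}$, and $A\in\mathcal{I}$, $B\subset A$ implies $B\in\mathcal{I}$; it is admissible if $\{n\}\in\mathcal{I}$ for every $n\in\mathbb{N}$. A homeomorphism $h:X\to Y$ is a uniform homeomorphism if $h$ is uniformly continuous on $X$ and $h^{-1}$ is uniformly continuous on $Y$. Sequences $F=\{f_n\}$ of maps $X\to X$ and $G=\{g_n\}$ of maps $Y\to Y$ are $h$-conjugate, for a homeomorphism $h:X\to Y$, if $g_k(h(x))=h(f_k(x))$ for every $k\in\mathbb{N}$ and every $x\in X$; they are uniformly $h$-conjugate if moreover $h$ is a uniform homeomorphism. A sequence $\{f_n\}$ of functions from a metric space $(X,d)$ to a metric space $(Z,\sigma)$ is $\mathcal{I}$-exhaustive at $x\in X$ if for every $\varepsilon>0$ there exist $\delta>0$ and $A\in\mathcal{I}$ (depending on $\varepsilon$ and $x$) such that $\sigma(f_n(x),f_n(y))<\varepsilon$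 for all $n\in\mathbb{N}\setminus A$ and all $y\in X$ with $d(x,y)<\delta$. It is $\mathcal{I}$-exhaustive on $X$ if it is $\mathcal{I}$-exhaustive at every $x\in X$. *)

theory Defs
  imports "HOL-Analysis.Abstract_Metric_Spaces"
begin

text \<open>
  The index set of all sequences below is the set of positive integers, \<open>{1..}\<close> in type
  \<^typ>\<open>nat\<close>; the value of a sequence at \<open>0\<close> plays no role.  Metric spaces are
  elements of \<^typ>\<open>'a metric\<close>, that is, a carrier set together with a metric on it, so
  the carrier need not be a whole type.
\<close>

definition ideal_on_posnat :: "nat set set \<Rightarrow> bool" where
  "ideal_on_posnat \<I> \<longleftrightarrow>
     \<I> \<subseteq> Pow {1..} \<and>
     (\<forall>A B. A \<in> \<I> \<longrightarrow> B \<in> \<I> \<longrightarrow> A \<union> B \<in> \<I>) \<and>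
     (\<forall>A B. A \<in> \<I> \<longrightarrow> B \<subseteq> A \<longrightarrow> B \<in> \<I>)"

text \<open>Properness (\<open>{1..} \<notin> \<I>\<close>) is deliberately not required.\<close>

definition admissible_ideal :: "nat set set \<Rightarrow> bool" where
  "admissible_ideal \<I> \<longleftrightarrow> ideal_on_posnat \<I> \<and> (\<forall>n\<ge>1. {n} \<in> \<I>)"

definition uniform_homeomorphism :: "'a metric \<Rightarrow> 'b metric \<Rightarrow> ('a \<Rightarrow> 'b) \<Rightarrow> bool" where
  "uniform_homeomorphism X Y h \<longleftrightarrow>
     homeomorphic_map (mtopology_of X) (mtopology_of Y) h \<and>
     uniformly_continuous_map X Y h \<and>
     uniformly_continuous_map Y X (inv_into (mspace X) h)"

definition conjugate_seqs ::
  "'a metric \<Rightarrow> 'b metric \<Rightarrow> ('a \<Rightarrow> 'b) \<Rightarrow> (nat \<Rightarrow> 'a \<Rightarrow> 'a) \<Rightarrow> (nat \<Rightarrow> 'b \<Rightarrow> 'b) \<Rightarrow> bool" where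
  "conjugate_seqs X Y h f g \<longleftrightarrow>
     homeomorphic_map (mtopology_of X) (mtopology_of Y) h \<and>
     (\<forall>k\<ge>1. \<forall>x\<in>mspace X. g k (h x) = h (f k x))"

definition uniformly_conjugate_seqs ::
  "'a metric \<Rightarrow> 'b metric \<Rightarrow> ('a \<Rightarrow> 'b) \<Rightarrow> (nat \<Rightarrow> 'a \<Rightarrow> 'a) \<Rightarrow> (nat \<Rightarrow> 'b \<Rightarrow> 'b) \<Rightarrow> bool" where
  "uniformly_conjugate_seqs X Y h f g \<longleftrightarrow>
     conjugate_seqs X Y h f g \<and> uniform_homeomorphism X Y h"

definition ideal_exhaustive_at ::
  "nat set set \<Rightarrow> 'a metric \<Rightarrow> 'b metric \<Rightarrow> (nat \<Rightarrow> 'a \<Rightarrow> 'b) \<Rightarrow> 'a \<Rightarrow> bool" where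
  "ideal_exhaustive_at \<I> X Z f x \<longleftrightarrow>
     (\<forall>\<epsilon>>0. \<exists>\<delta>>0. \<exists>A\<in>\<I>. \<forall>n\<in>{1..} - A. \<forall>y\<in>mspace X.
        mdist X x y < \<delta> \<longrightarrow> mdist Z (f n x) (f n y) < \<epsilon>)"

definition ideal_exhaustive ::
  "nat set set \<Rightarrow> 'a metric \<Rightarrow> 'b metric \<Rightarrow> (nat \<Rightarrow> 'a \<Rightarrow> 'b) \<Rightarrow> bool" where
  "ideal_exhaustive \<I> X Z f \<longleftrightarrow> (\<forall>x\<in>mspace X. ideal_exhaustive_at \<I> X Z f x)"

end

theory Submission
  imports Defs
begin

text \<open>On \<open>Y\<close> each \<open>g n\<close> with \<open>n \<ge> 1\<close> is the
  conjugate of \<open>f n\<close> by \<open>h\<close>, so closeness of \<open>g n y\<close> and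
  \<open>g n z\<close> reduces to closeness of \<open>f n\<close> at the preimages of
  \<open>y\<close> and \<open>z\<close>. Three moduli are chained backwards: uniform continuity of
  \<open>h\<close> turns \<epsilon> into \<eta>, exhaustiveness of \<open>f\<close> at the preimage
  of \<open>y\<close> turns \<eta> into \<gamma>, and continuity of the inverse turns \<gamma> into
  \<delta>. The exceptional set in \<open>\<I>\<close> is carried over unchanged.\<close>

theorem theorem4p1:
  fixes \<I> :: "nat set set"
    and X :: "'a metric" and Y :: "'b metric"
    and h :: "'a \<Rightarrow> 'b"
    and f :: "nat \<Rightarrow> 'a \<Rightarrow> 'a" and g :: "nat \<Rightarrow> 'b \<Rightarrow> 'b"
  assumes "admissible_ideal \<I>"
    and "uniform_homeomorphism X Y h"
    and "\<And>n. n \<ge> 1 \<Longrightarrow> f n \<in> mspace X \<rightarrow> mspace X"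
    and "\<And>n. n \<ge> 1 \<Longrightarrow> g n \<in> mspace Y \<rightarrow> mspace Y"
    and "uniformly_conjugate_seqs X Y h f g"
    and "ideal_exhaustive \<I> X X f"
  shows "ideal_exhaustive \<I> Y Y g"
proof (unfold ideal_exhaustive_def ideal_exhaustive_at_def, intro ballI allI impI)
  fix y and \<epsilon> :: real
  assume y: "y \<in> mspace Y" and "\<epsilon> > 0"
  define k where "k = inv_into (mspace X) h"
  have hom: "homeomorphic_map (mtopology_of X) (mtopology_of Y) h"
    and unif_h: "uniformly_continuous_map X Y h"
    and unif_k: "uniformly_continuous_map Y X k"
    using assms(2) by (simp_all add: uniform_homeomorphism_def k_def)
  have g_h: "g n (h x) = h (f n x)" if "n \<ge> 1" "x \<in> mspace X" for n x
    using assms(5) that by (simp add: uniformly_conjugate_seqs_def conjugate_seqs_def)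
  \<comment> \<open>Surjectivity of \<open>h\<close> onto the carrier of \<open>Y\<close> makes
    \<open>inv_into\<close> a genuine right inverse there.\<close>
  have k_in: "k z \<in> mspace X" and h_k: "h (k z) = z" if "z \<in> mspace Y" for z
    using homeomorphic_imp_surjective_map[OF hom] that
    by (auto simp: k_def inv_into_into f_inv_into_f)
  have g_eq: "g n z = h (f n (k z))" if "n \<ge> 1" "z \<in> mspace Y" for n z
    using g_h[OF that(1) k_in[OF that(2)]] h_k[OF that(2)] by simp
  \<comment> \<open>Uniformity of \<open>h\<close> is essential to this argument: \<eta> is applied
    at the points \<open>f n (k y)\<close>, which move with \<open>n\<close>, so it must not depend
    on the base point.\<close>
  obtain \<eta> where "\<eta> > 0" and \<eta>: "\<And>a b. a \<in> mspace X \<Longrightarrow> b \<in> mspace X \<Longrightarrow>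
      mdist X a b < \<eta> \<Longrightarrow> mdist Y (h a) (h b) < \<epsilon>"
    using unif_h \<open>\<epsilon> > 0\<close> unfolding uniformly_continuous_map_def by meson
  obtain \<gamma> A where "\<gamma> > 0" "A \<in> \<I>"
    and \<gamma>: "\<And>n x. n \<in> {1..} - A \<Longrightarrow> x \<in> mspace X \<Longrightarrow> mdist X (k y) x < \<gamma> \<Longrightarrow>
      mdist X (f n (k y)) (f n x) < \<eta>"
    using assms(6) k_in[OF y] \<open>\<eta> > 0\<close>
    unfolding ideal_exhaustive_def ideal_exhaustive_at_def by meson
  obtain \<delta> where "\<delta> > 0" and \<delta>: "\<And>a b. a \<in> mspace Y \<Longrightarrow> b \<in> mspace Y \<Longrightarrow>
      mdist Y a b < \<delta> \<Longrightarrow> mdist X (k a) (k b) < \<gamma>"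
    using unif_k \<open>\<gamma> > 0\<close> unfolding uniformly_continuous_map_def by meson
  have "mdist Y (g n y) (g n z) < \<epsilon>"
    if n: "n \<in> {1..} - A" and z: "z \<in> mspace Y" and d: "mdist Y y z < \<delta>" for n z
  proof -
    have "n \<ge> 1"
      using n by simp
    \<comment> \<open>The modulus \<eta> controls \<open>h\<close> only between points of the
      carrier, so the images under \<open>f n\<close> must be known to stay in it.\<close>
    then have "f n (k y) \<in> mspace X" "f n (k z) \<in> mspace X"
      using assms(3) k_in y z by blast+
    then have "mdist Y (h (f n (k y))) (h (f n (k z))) < \<epsilon>"
      using \<eta> \<gamma>[OF n k_in[OF z] \<delta>[OF y z d]] by blast
    then show ?thesis
      using g_eq[OF \<open>n \<ge> 1\<close>] y z by simp
  qed
  with \<open>\<delta> > 0\<close> \<open>A \<in> \<I>\<close>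
  show "\<exists>\<delta>>0. \<exists>A\<in>\<I>. \<forall>n\<in>{1..} - A. \<forall>z\<in>mspace Y.
      mdist Y y z < \<delta> \<longrightarrow> mdist Y (g n y) (g n z) < \<epsilon>"
    by blast
qed

end
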